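(* Let $m \ge 1$ and $n > t \ge 0$ be integers, let $X$ be a nonempty set, and let $B_1,\dots,B_m$ be Hamming balls of radius $t$ in $X^n$ centered at $a_1,\dots,a_m \in X^n$, respectively. There is an absolute constant $c > 0$ such that: (1) If $X$ is finite and, for some $\alpha > 12/m$, at least $\alpha\binom{m}{2}$ unordered pairs $\{i,j\}$ of distinct indices satisfy $B_i \cap B_j \ne \emptyset$, then some point of $X^n$ lies in at least $c\,\alpha^2 |X|^{-t} \binom{4t}{t}^{-1} m$ of the balls $B_1,\dots,B_m$. (2) If, for some $\alpha > 0$, at least $\alpha\binom{m}{t+2}$ of the $(t+2)$-element subsets $I \subseteq [m]$ satisfy $\bigcap_{i \in I} B_i \ne \emptyset$, then some point of $X^n$ lies in at least $c\,\alpha\, m/(e(t+1))^{t+1}$ of the balls $B_1,\dots,B_m$.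
   Context: For $p,q \in X^n$, $\mathrm{dist}(p,q)$ is the Hamming distance (number of coordinates in which they differ). The Hamming ball of radius $t$ centered at $x \in X^n$ is $B(x,t) = \{p \in X^n : \mathrm{dist}(p,x) \le t\}$.
   Formalization: The condition α ≤ 1 is added in (1) and (2); it is automatic when the binomial coefficient (m choose 2, resp. m choose t+2) is positive, and when that is zero the claim fails for large α (e.g. m = 1, t = 0). *)

theory Defs
  imports Complex_Main "HOL-Library.FuncSet"
begin

text \<open>Points of \<open>X\<^sup>n\<close> are the functions in \<open>{..<n} \<rightarrow>\<^sub>E X\<close>; the distance only looks at
  the coordinates below \<open>n\<close>.\<close>

definition hamming_dist :: "nat \<Rightarrow> (nat \<Rightarrow> 'a) \<Rightarrow> (nat \<Rightarrow> 'a) \<Rightarrow> nat" where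
  "hamming_dist n p q = card {k. k < n \<and> p k \<noteq> q k}"

definition hamming_ball :: "nat \<Rightarrow> 'a set \<Rightarrow> nat \<Rightarrow> (nat \<Rightarrow> 'a) \<Rightarrow> (nat \<Rightarrow> 'a) set" where
  "hamming_ball n X t x = {p \<in> {..<n} \<rightarrow>\<^sub>E X. hamming_dist n p x \<le> t}"

text \<open>In both properties below \<open>\<alpha>\<close> is the proportion of intersecting subfamilies, whence \<open>\<alpha> \<le> 1\<close>.
  This bound follows from the other hypotheses as soon as the binomial coefficient
  (\<open>m choose 2\<close>, resp. \<open>m choose (t + 2)\<close>) is nonzero. When it is zero, the counting hypothesis
  holds for every \<open>\<alpha>\<close>, and without the bound the conclusion would fail for large \<open>\<alpha>\<close>.\<close>

definition pairs_property ::
  "real \<Rightarrow> nat \<Rightarrow> nat \<Rightarrow> nat \<Rightarrow> 'a set \<Rightarrow> (nat \<Rightarrow> nat \<Rightarrow> 'a) \<Rightarrow> bool" where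
  "pairs_property c m n t X a \<longleftrightarrow>
    (let B = (\<lambda>i. hamming_ball n X t (a i)) in
      finite X \<longrightarrow>
      (\<forall>\<alpha>::real. 12 / real m < \<alpha> \<longrightarrow> \<alpha> \<le> 1 \<longrightarrow>
        \<alpha> * real (m choose 2)
          \<le> real (card {{i, j} |i j. i \<in> {1..m} \<and> j \<in> {1..m} \<and> i \<noteq> j \<and> B i \<inter> B j \<noteq> {}}) \<longrightarrow>
        (\<exists>p \<in> {..<n} \<rightarrow>\<^sub>E X.
          c * \<alpha>\<^sup>2 * (1 / real (card X) ^ t) * (1 / real ((4 * t) choose t)) * real m
            \<le> real (card {i \<in> {1..m}. p \<in> B i}))))"

definition subsets_property ::
  "real \<Rightarrow> nat \<Rightarrow> nat \<Rightarrow> nat \<Rightarrow> 'a set \<Rightarrow> (nat \<Rightarrow> nat \<Rightarrow> 'a) \<Rightarrow> bool" where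
  "subsets_property c m n t X a \<longleftrightarrow>
    (let B = (\<lambda>i. hamming_ball n X t (a i)) in
      (\<forall>\<alpha>::real. 0 < \<alpha> \<longrightarrow> \<alpha> \<le> 1 \<longrightarrow>
        \<alpha> * real (m choose (t + 2))
          \<le> real (card {I. I \<subseteq> {1..m} \<and> card I = t + 2 \<and> (\<Inter>i\<in>I. B i) \<noteq> {}}) \<longrightarrow>
        (\<exists>p \<in> {..<n} \<rightarrow>\<^sub>E X.
          c * \<alpha> * real m / (exp 1 * real (t + 1)) ^ (t + 1)
            \<le> real (card {i \<in> {1..m}. p \<in> B i}))))"

definition works_for_alphabet :: "real \<Rightarrow> 'a set \<Rightarrow> bool" where
  "works_for_alphabet c X \<longleftrightarrow>
    (\<forall>m n t a. 1 \<le> m \<longrightarrow> t < n \<longrightarrow> (\<forall>i\<in>{1..m}. a i \<in> {..<n} \<rightarrow>\<^sub>E X) \<longrightarrow>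
      pairs_property c m n t X a \<and> subsets_property c m n t X a)"

text \<open>A HOL existential \<open>\<exists>c>0. \<forall>X :: 'a set. \<dots>\<close> does not by itself prevent \<open>c\<close> from depending on
  the type \<open>'a\<close>. To make the constant absolute, one also asserts that a constant which works for
  all nonempty alphabets of type \<^typ>\<open>nat set\<close> works for all those of type \<open>'a set\<close>:
  the constant obtained for \<^typ>\<open>nat\<close> is then valid at every type.\<close>

end

theory Submission
  imports Defs
begin

text \<open>Intersecting balls have centres at distance at most \<open>2 t\<close>. By convexity at least
  \<open>\<alpha>\<^sup>2 m\<^sup>3\<close> triples of centres have an apex within \<open>2 t\<close> of the two others. If \<open>y\<close>, \<open>z\<close> are the ends
  of a longest side of such a triple, the third centre \<open>x\<close> differs from \<open>y\<close> in at most \<open>t\<close>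
  coordinates where \<open>y\<close> and \<open>z\<close> agree, so one gets within \<open>t\<close> of \<open>x\<close> by changing \<open>y\<close> on \<open>t\<close> of the at
  most \<open>4 t\<close> coordinates where \<open>y\<close> and \<open>z\<close> differ. Some pair \<open>(y, z)\<close> serves \<open>\<alpha>\<^sup>2 m / 3\<close> third centres,
  and there are at most \<open>(4 t choose t) |X|\<^sup>t\<close> such changes.

  For the second property, a common point of \<open>t + 2\<close> balls is found by a branching procedure that
  starts at a centre, has at most \<open>(t + 1)\<^sup>t\<close> outcomes and consults at most \<open>t + 1\<close> of the balls.
  Hence every intersecting \<open>(t + 2)\<close>-subset is a \<open>(t + 1)\<close>-subset together with one of the balls
  that contain one of its \<open>(t + 1)\<^sup>t\<close> candidate points. Both parts hold with \<open>c = 1/4\<close>.\<close>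

section \<open>Union bounds and supersets of prescribed size\<close>

lemma card_le_cover:
  assumes "A \<subseteq> (\<Union>b\<in>B. F b)" "finite B" "\<And>b. b \<in> B \<Longrightarrow> finite (F b) \<and> card (F b) \<le> N"
  shows "card A \<le> card B * N"
proof -
  have "card A \<le> card (\<Union>b\<in>B. F b)"
    using assms by (intro card_mono) auto
  also have "\<dots> \<le> (\<Sum>b\<in>B. card (F b))"
    using assms(2) by (rule card_UN_le)
  also have "\<dots> \<le> card B * N"
    using assms(3) sum_bounded_above[of B "\<lambda>b. card (F b)" N] by simp
  finally show ?thesis .
qed

lemma card_split_le:
  assumes "A \<subseteq> B \<union> C" "finite B" "finite C"
  shows "card A \<le> card B + card C"
  by (meson assms card_Un_le card_mono finite_UnI le_trans)

lemma obtain_superset_card: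
  assumes "S \<subseteq> A" "finite A" "card S \<le> k" "k \<le> card A"
  obtains T where "S \<subseteq> T" "T \<subseteq> A" "card T = k"
proof -
  have "finite S" using assms finite_subset by blast
  then have "k - card S \<le> card (A - S)"
    using assms by (simp add: card_Diff_subset)
  then obtain R where R: "R \<subseteq> A - S" "card R = k - card S" "finite R"
    by (rule obtain_subset_with_card_n)
  have "card (S \<union> R) = k"
    using R assms \<open>finite S\<close> by (subst card_Un_disjoint) auto
  then show ?thesis using that[of "S \<union> R"] R assms by auto
qed

subsection \<open>Hamming distance\<close>

lemma hamming_dist_commute: "hamming_dist n p q = hamming_dist n q p"
  by (simp add: hamming_dist_def eq_commute)

lemma hamming_dist_self [simp]: "hamming_dist n p p = 0"
  by (simp add: hamming_dist_def)

lemma hamming_dist_triangle: "hamming_dist n p r \<le> hamming_dist n p q + hamming_dist n q r"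
  unfolding hamming_dist_def by (rule card_split_le) auto

lemma hamming_dist_cong:
  "(\<And>k. k < n \<Longrightarrow> p k = p' k) \<Longrightarrow> hamming_dist n p q = hamming_dist n p' q"
  unfolding hamming_dist_def by (rule arg_cong[where f = card]) auto

text \<open>A coordinate in \<open>E\<close> counts towards both \<open>d(x,y)\<close> and
  \<open>d(x,z)\<close> but not towards \<open>d(y,z)\<close>, and every other disagreement of
  \<open>y\<close> and \<open>z\<close> is one of \<open>x\<close> with \<open>y\<close> or with
  \<open>z\<close>. So \<open>2 card E + d(y,z) \<le> d(x,y) + d(x,z)\<close>; cancelling
  \<open>d(x,y) \<le> d(y,z)\<close> leaves \<open>2 card E \<le> d(x,z) \<le> 2 t\<close>.\<close>

lemma card_agreement_of_longest_side:
  fixes x y z :: "nat \<Rightarrow> 'a"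
  assumes "hamming_dist n x y \<le> hamming_dist n y z" "hamming_dist n x z \<le> hamming_dist n y z"
    and "hamming_dist n x y \<le> 2 * t" "hamming_dist n x z \<le> 2 * t"
  shows "card {k. k < n \<and> x k \<noteq> y k \<and> y k = z k} \<le> t"
proof -
  define E where "E = {k. k < n \<and> x k \<noteq> y k \<and> y k = z k}"
  define P where "P = {k. k < n \<and> x k \<noteq> y k \<and> y k \<noteq> z k}"
  define Q where "Q = {k. k < n \<and> x k \<noteq> z k \<and> y k \<noteq> z k}"
  have fin: "finite E" "finite P" "finite Q" by (auto simp: E_def P_def Q_def)
  have "{k. k < n \<and> x k \<noteq> y k} = E \<union> P" "E \<inter> P = {}" by (auto simp: E_def P_def)
  then have 1: "hamming_dist n x y = card E + card P"
    using fin by (simp add: hamming_dist_def card_Un_disjoint)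
  have "{k. k < n \<and> x k \<noteq> z k} = E \<union> Q" "E \<inter> Q = {}" by (auto simp: E_def Q_def)
  then have 2: "hamming_dist n x z = card E + card Q"
    using fin by (simp add: hamming_dist_def card_Un_disjoint)
  have "hamming_dist n y z \<le> card P + card Q"
    unfolding hamming_dist_def using fin by (intro card_split_le) (auto simp: P_def Q_def)
  then have "card E \<le> t" using 1 2 assms by linarith
  then show ?thesis by (simp add: E_def)
qed

text \<open>The maximum is attained even over an infinite \<open>A\<close>, because the counts take
  only the finitely many values up to \<open>card J\<close>.\<close>

lemma obtain_most_covering_point:
  fixes B :: "nat \<Rightarrow> 'b set"
  assumes "finite J" "A \<noteq> {}"
  obtains p where "p \<in> A" "\<forall>q\<in>A. card {i \<in> J. q \<in> B i} \<le> card {i \<in> J. p \<in> B i}"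
proof -
  define M where "M = Max ((\<lambda>q. card {i \<in> J. q \<in> B i}) ` A)"
  have fin: "finite ((\<lambda>q. card {i \<in> J. q \<in> B i}) ` A)"
    by (rule finite_subset[of _ "{..card J}"]) (auto intro!: card_mono assms)
  have "M \<in> (\<lambda>q. card {i \<in> J. q \<in> B i}) ` A"
    unfolding M_def using fin assms by (intro Max_in) auto
  then obtain p where "p \<in> A" "M = card {i \<in> J. p \<in> B i}" by auto
  moreover have "card {i \<in> J. q \<in> B i} \<le> M" if "q \<in> A" for q
    unfolding M_def using fin that by (intro Max_ge) auto
  ultimately show ?thesis using that by auto
qed

subsection \<open>Intersecting pairs\<close>

text \<open>\<open>S\<close> may contain indices \<open>\<ge> n\<close>: it is taken inside a set of exactly \<open>4 t\<close> naturals, while \<open>n\<close>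
  may be smaller than \<open>4 t\<close>.\<close>

definition modifications :: "nat \<Rightarrow> 'a set \<Rightarrow> (nat \<Rightarrow> 'a) \<Rightarrow> nat set \<Rightarrow> (nat \<Rightarrow> 'a) set" where
  "modifications n X y S =
    (\<lambda>g k. if k \<in> S \<inter> {..<n} then g k else y k) ` ((S \<inter> {..<n}) \<rightarrow>\<^sub>E X)"

lemma card_modifications:
  assumes "finite X" "X \<noteq> {}" "finite S"
  shows "finite (modifications n X y S)" "card (modifications n X y S) \<le> card X ^ card S"
proof -
  have fin: "finite ((S \<inter> {..<n}) \<rightarrow>\<^sub>E X)" using assms by (intro finite_PiE) auto
  then show "finite (modifications n X y S)" by (simp add: modifications_def)
  have "card (modifications n X y S) \<le> card ((S \<inter> {..<n}) \<rightarrow>\<^sub>E X)"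
    unfolding modifications_def using fin by (rule card_image_le)
  also have "\<dots> = card X ^ card (S \<inter> {..<n})" by (simp add: card_PiE)
  also have "\<dots> \<le> card X ^ card S"
    using assms by (intro power_increasing card_mono) (auto simp: Suc_le_eq card_gt_0_iff)
  finally show "card (modifications n X y S) \<le> card X ^ card S" .
qed

lemma modifications_subset:
  assumes "y \<in> {..<n} \<rightarrow>\<^sub>E X"
  shows "modifications n X y S \<subseteq> {..<n} \<rightarrow>\<^sub>E X"
  using assms by (auto simp: modifications_def PiE_iff extensional_def)

text \<open>Copying \<open>x\<close> onto \<open>y\<close> over \<open>S\<close> repairs every
  disagreement in \<open>S\<close>, so \<open>S\<close> should swallow as much of
  \<open>E \<union> P\<close> as possible. If \<open>P\<close> has at most \<open>t\<close>
  elements, \<open>S\<close> contains all of it and only \<open>E\<close> is left, of size at most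
  \<open>t\<close>. Otherwise \<open>S\<close> is a part of \<open>P\<close>, and at most
  \<open>2 t - t\<close> of the at most \<open>2 t\<close> disagreements survive.\<close>

lemma obtain_close_modification:
  assumes x: "x \<in> {..<n} \<rightarrow>\<^sub>E X" and D: "finite D" "t \<le> card D"
    and sub: "{k. k < n \<and> y k \<noteq> z k} \<subseteq> D"
    and dist: "hamming_dist n x y \<le> hamming_dist n y z" "hamming_dist n x z \<le> hamming_dist n y z"
      "hamming_dist n x y \<le> 2 * t" "hamming_dist n x z \<le> 2 * t"
  obtains S p where "S \<subseteq> D" "card S = t" "p \<in> modifications n X y S" "hamming_dist n p x \<le> t"
proof -
  define E where "E = {k. k < n \<and> x k \<noteq> y k \<and> y k = z k}"
  define P where "P = {k. k < n \<and> x k \<noteq> y k \<and> y k \<noteq> z k}"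
  have E: "card E \<le> t" unfolding E_def by (rule card_agreement_of_longest_side[OF dist])
  have fin: "finite E" "finite P" by (auto simp: E_def P_def)
  have un: "{k. k < n \<and> x k \<noteq> y k} = E \<union> P" "E \<inter> P = {}" by (auto simp: E_def P_def)
  then have xy: "card E + card P \<le> 2 * t"
    using fin dist by (simp add: hamming_dist_def card_Un_disjoint)
  have PD: "P \<subseteq> D" using sub by (auto simp: P_def)
  obtain S where S: "S \<subseteq> D" "card S = t" "card (E \<union> P - S) \<le> t"
  proof (cases "card P \<le> t")
    case True
    then obtain S where S: "P \<subseteq> S" "S \<subseteq> D" "card S = t"
      using obtain_superset_card[OF PD] D by metis
    then have "card (E \<union> P - S) \<le> card E" using fin by (intro card_mono) auto
    then show ?thesis using S E that by force
  next
    case False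
    then obtain S where S: "S \<subseteq> P" "card S = t" "finite S"
      using obtain_subset_with_card_n[of t P] by auto
    then have "card (E \<union> P - S) = card E + card P - t"
      using un fin by (subst card_Diff_subset) (auto simp: card_Un_disjoint)
    then show ?thesis using S PD xy that[of S] by force
  qed
  \<comment> \<open>\<open>p\<close> is \<open>y\<close> overwritten by \<open>x\<close> on
    \<open>S\<close>; restricting \<open>x\<close> makes the overwriting function extensional, as
    the index set of \<open>modifications\<close> demands.\<close>
  define p where "p = (\<lambda>k. if k \<in> S \<inter> {..<n} then restrict x (S \<inter> {..<n}) k else y k)"
  have "restrict x (S \<inter> {..<n}) \<in> (S \<inter> {..<n}) \<rightarrow>\<^sub>E X"
    using x by auto
  with p_def have "p \<in> modifications n X y S"
    unfolding modifications_def by (rule image_eqI)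
  moreover have "{k. k < n \<and> p k \<noteq> x k} \<subseteq> E \<union> P - S"
    unfolding un(1)[symmetric] by (auto simp: p_def)
  then have "hamming_dist n p x \<le> t"
    unfolding hamming_dist_def using S(3) fin card_mono[of "E \<union> P - S"] by (meson finite_Diff finite_UnI le_trans)
  ultimately show ?thesis using that S by blast
qed

text \<open>Each third centre is within \<open>t\<close> of some modification of \<open>y\<close>,
  hence is one of the at most \<open>M\<close> centres whose balls contain that modification. The
  factors count the set \<open>S\<close>, the values put on \<open>S\<close>, and the centres
  served. Padding \<open>D\<close> to exactly \<open>4 t\<close> elements gives the number of
  choices of \<open>S\<close> and leaves room for \<open>t\<close> of them.\<close>

lemma card_third_points_le:
  fixes a :: "'i \<Rightarrow> nat \<Rightarrow> 'a"
  assumes X: "finite X" "X \<noteq> {}" and "finite J" and a: "\<And>i. i \<in> J \<Longrightarrow> a i \<in> {..<n} \<rightarrow>\<^sub>E X"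
    and yz: "y \<in> {..<n} \<rightarrow>\<^sub>E X" "hamming_dist n y z \<le> 4 * t"
    and M: "\<And>p. p \<in> {..<n} \<rightarrow>\<^sub>E X \<Longrightarrow> card {i \<in> J. p \<in> hamming_ball n X t (a i)} \<le> M"
  shows "card {i \<in> J. hamming_dist n (a i) y \<le> hamming_dist n y z \<and>
      hamming_dist n (a i) z \<le> hamming_dist n y z \<and>
      hamming_dist n (a i) y \<le> 2 * t \<and> hamming_dist n (a i) z \<le> 2 * t}
    \<le> ((4 * t) choose t) * (card X ^ t * M)" (is "card ?A \<le> _")
proof -
  obtain D :: "nat set" where D: "{k. k < n \<and> y k \<noteq> z k} \<subseteq> D" "finite D" "card D = 4 * t"
  proof -
    have "{k. k < n \<and> y k \<noteq> z k} \<subseteq> {..<n + 4 * t}" by auto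
    moreover have "finite {..<n + 4 * t}" "card {k. k < n \<and> y k \<noteq> z k} \<le> 4 * t" "4 * t \<le> card {..<n + 4 * t}"
      using yz(2) by (simp_all add: hamming_dist_def)
    ultimately obtain D where "{k. k < n \<and> y k \<noteq> z k} \<subseteq> D" "D \<subseteq> {..<n + 4 * t}" "card D = 4 * t"
      by (rule obtain_superset_card)
    then show ?thesis using that finite_subset[of D "{..<n + 4 * t}"] by blast
  qed
  define cov where "cov = (\<lambda>p. {i \<in> J. p \<in> hamming_ball n X t (a i)})"
  define \<S> where "\<S> = {S. S \<subseteq> D \<and> card S = t}"
  have fS: "finite \<S>" "card \<S> = (4 * t) choose t"
    unfolding \<S>_def using D n_subsets[of D t] by auto
  have "?A \<subseteq> (\<Union>S\<in>\<S>. \<Union>p\<in>modifications n X y S. cov p)"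
  proof
    fix i assume i: "i \<in> ?A"
    then have iJ: "i \<in> J" and dist: "hamming_dist n (a i) y \<le> hamming_dist n y z"
      "hamming_dist n (a i) z \<le> hamming_dist n y z"
      "hamming_dist n (a i) y \<le> 2 * t" "hamming_dist n (a i) z \<le> 2 * t" by auto
    have "t \<le> card D" using D(3) by simp
    then obtain S p where S: "S \<subseteq> D" "card S = t"
      and p: "p \<in> modifications n X y S" "hamming_dist n p (a i) \<le> t"
      by (rule obtain_close_modification[OF a[OF iJ] D(2) _ D(1) dist])
    have "p \<in> {..<n} \<rightarrow>\<^sub>E X" using p(1) modifications_subset[OF yz(1)] by blast
    then have "i \<in> cov p" using iJ p(2) unfolding cov_def hamming_ball_def by blast
    moreover have "S \<in> \<S>" using S by (simp add: \<S>_def)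
    ultimately show "i \<in> (\<Union>S\<in>\<S>. \<Union>p\<in>modifications n X y S. cov p)"
      using p(1) by blast
  qed
  moreover have "finite (\<Union>p\<in>modifications n X y S. cov p) \<and>
      card (\<Union>p\<in>modifications n X y S. cov p) \<le> card X ^ t * M" if "S \<in> \<S>" for S
  proof -
    have S: "finite S" "card S = t" using that rev_finite_subset[OF D(2)] by (simp_all add: \<S>_def)
    note c = card_modifications[OF X S(1), of n y]
    have "finite (cov p) \<and> card (cov p) \<le> M" if "p \<in> modifications n X y S" for p
    proof -
      have "p \<in> {..<n} \<rightarrow>\<^sub>E X" using that modifications_subset[OF yz(1)] by blast
      then show ?thesis using M \<open>finite J\<close> by (simp add: cov_def)
    qed
    then have "card (\<Union>p\<in>modifications n X y S. cov p) \<le> card (modifications n X y S) * M"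
      by (rule card_le_cover[OF subset_refl c(1)])
    also have "\<dots> \<le> card X ^ t * M" using c(2) S by simp
    finally show ?thesis using c(1) \<open>finite J\<close> by (auto simp: cov_def)
  qed
  ultimately have "card ?A \<le> card \<S> * (card X ^ t * M)"
    by (rule card_le_cover[OF _ fS(1)])
  then show ?thesis by (simp only: fS(2))
qed

section \<open>Double counting of pairs and of triples with an apex\<close>

lemma card_offdiagonal_pairs:
  fixes R :: "nat \<Rightarrow> nat \<Rightarrow> bool"
  assumes "finite J" and sym: "\<And>i j. R i j \<Longrightarrow> R j i"
  shows "2 * card {{i, j} |i j. i \<in> J \<and> j \<in> J \<and> i \<noteq> j \<and> R i j}
    \<le> card {(i, j). i \<in> J \<and> j \<in> J \<and> i \<noteq> j \<and> R i j}"
proof -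
  define L where "L = {(i, j). i \<in> J \<and> j \<in> J \<and> i < j \<and> R i j}"
  have fL: "finite L" by (rule finite_subset[of _ "J \<times> J"]) (use assms in \<open>auto simp: L_def\<close>)
  have "{{i, j} |i j. i \<in> J \<and> j \<in> J \<and> i \<noteq> j \<and> R i j} \<subseteq> (\<lambda>(i, j). {i, j}) ` L"
  proof clarify
    fix i j assume "i \<in> J" "j \<in> J" "i \<noteq> j" "R i j"
    then have "(i, j) \<in> L \<or> (j, i) \<in> L" using sym by (auto simp: L_def)
    then show "{i, j} \<in> (\<lambda>(i, j). {i, j}) ` L" by (force simp: insert_commute)
  qed
  then have 1: "card {{i, j} |i j. i \<in> J \<and> j \<in> J \<and> i \<noteq> j \<and> R i j} \<le> card L"
    using fL by (rule surj_card_le[rotated])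
  have "card {(i, j). i \<in> J \<and> j \<in> J \<and> i \<noteq> j \<and> R i j} = card (L \<union> prod.swap ` L)"
    using sym by (intro arg_cong[where f = card]) (auto simp: L_def image_iff)
  also have "\<dots> = card L + card (prod.swap ` L)"
    using fL by (intro card_Un_disjoint) (auto simp: L_def)
  also have "card (prod.swap ` L) = card L" by (rule card_image) auto
  finally show ?thesis using 1 by simp
qed

text \<open>Grouping the triples by their apex \<open>u\<close> gives the sum of the squared
  degrees, while \<open>\<beta>\<close> bounds the average degree from below. Convexity enters
  through the tangent line of the square at \<open>\<beta>\<close>: a degree \<open>d\<close>
  satisfies \<open>2 \<beta> d - \<beta>\<^sup>2 \<le> d\<^sup>2\<close>, and summing this over
  \<open>J\<close> suffices.\<close>

lemma card_cherries_ge: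
  fixes R :: "'i \<Rightarrow> 'i \<Rightarrow> bool"
  assumes "finite J" and "\<beta> * real (card J) \<le> real (card {(i, j). i \<in> J \<and> j \<in> J \<and> R i j})"
    and "0 \<le> \<beta>"
  shows "\<beta>\<^sup>2 * real (card J)
    \<le> real (card {(u, v, w). u \<in> J \<and> v \<in> J \<and> w \<in> J \<and> R u v \<and> R u w})"
proof -
  define N where "N = (\<lambda>u. {v \<in> J. R u v})"
  have fN: "finite (N u)" for u using assms by (simp add: N_def)
  have "{(i, j). i \<in> J \<and> j \<in> J \<and> R i j} = (SIGMA u:J. N u)" by (auto simp: N_def)
  then have deg: "card {(i, j). i \<in> J \<and> j \<in> J \<and> R i j} = (\<Sum>u\<in>J. card (N u))"
    using assms fN by simp
  have "{(u, v, w). u \<in> J \<and> v \<in> J \<and> w \<in> J \<and> R u v \<and> R u w} = (SIGMA u:J. N u \<times> N u)"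
    by (auto simp: N_def)
  then have ch: "card {(u, v, w). u \<in> J \<and> v \<in> J \<and> w \<in> J \<and> R u v \<and> R u w}
      = (\<Sum>u\<in>J. card (N u) * card (N u))"
    using assms fN by (simp add: card_cartesian_product)
  have "\<beta>\<^sup>2 * real (card J) = 2 * \<beta> * (\<beta> * real (card J)) - \<beta>\<^sup>2 * real (card J)"
    by (simp add: power2_eq_square)
  also have "\<dots> \<le> 2 * \<beta> * (\<Sum>u\<in>J. real (card (N u))) - \<beta>\<^sup>2 * real (card J)"
    using assms deg by (intro diff_right_mono mult_left_mono) auto
  also have "\<dots> = (\<Sum>u\<in>J. 2 * \<beta> * real (card (N u)) - \<beta>\<^sup>2)"
    by (simp add: sum_subtractf sum_distrib_left)
  also have "\<dots> \<le> (\<Sum>u\<in>J. real (card (N u)) * real (card (N u)))"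
  proof (rule sum_mono)
    fix u
    show "2 * \<beta> * real (card (N u)) - \<beta>\<^sup>2 \<le> real (card (N u)) * real (card (N u))"
      using zero_le_power2[of "\<beta> - real (card (N u))"] by (simp add: power2_eq_square algebra_simps)
  qed
  finally show ?thesis using ch by simp
qed

lemma pairs_property_fourth:
  fixes X :: "'a set"
  assumes "X \<noteq> {}" "1 \<le> m" and a: "\<And>i. i \<in> {1..m} \<Longrightarrow> a i \<in> {..<n} \<rightarrow>\<^sub>E X"
  shows "pairs_property (1/4) m n t X a"
  unfolding pairs_property_def Let_def
proof (intro impI allI)
  fix \<alpha> :: real
  define B where "B = (\<lambda>i. hamming_ball n X t (a i))"
  define J where "J = {1..m}"
  define d where "d = (\<lambda>i j. hamming_dist n (a i) (a j))"
  assume X: "finite X" and \<alpha>: "12 / real m < \<alpha>" "\<alpha> \<le> 1" and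
    "\<alpha> * real (m choose 2) \<le> real (card {{i, j} |i j. i \<in> {1..m} \<and> j \<in> {1..m} \<and> i \<noteq> j \<and>
        hamming_ball n X t (a i) \<inter> hamming_ball n X t (a j) \<noteq> {}})"
  then have hyp: "\<alpha> * real (m choose 2)
      \<le> real (card {{i, j} |i j. i \<in> J \<and> j \<in> J \<and> i \<noteq> j \<and> B i \<inter> B j \<noteq> {}})"
    by (simp only: B_def J_def)
  have "0 \<le> 12 / real m" by simp
  then have \<alpha>0: "0 \<le> \<alpha>" using \<alpha>(1) by linarith
  have J: "finite J" "card J = m" by (auto simp: J_def)
  have dsym: "d i j = d j i" for i j by (simp add: d_def hamming_dist_commute)
  have Bd: "d i j \<le> 2 * t" if meet: "B i \<inter> B j \<noteq> {}" for i j
  proof -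
    obtain p where "hamming_dist n p (a i) \<le> t" "hamming_dist n p (a j) \<le> t"
      using meet by (auto simp: B_def hamming_ball_def)
    then show ?thesis
      using hamming_dist_triangle[of n "a i" "a j" p] hamming_dist_commute[of n p "a i"]
      by (simp add: d_def)
  qed
  \<comment> \<open>The ordered pairs of distinct indices contribute
    \<open>\<alpha> m (m - 1)\<close>. The \<open>m\<close> diagonal pairs, at distance 0, make up
    for the missing \<open>\<alpha> m\<close> because \<open>\<alpha> \<le> 1\<close>.\<close>
  have deg: "\<alpha> * real m * real (card J) \<le> real (card {(i, j). i \<in> J \<and> j \<in> J \<and> d i j \<le> 2 * t})"
  proof -
    let ?O = "{(i, j). i \<in> J \<and> j \<in> J \<and> i \<noteq> j \<and> B i \<inter> B j \<noteq> {}}"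
    have fO: "finite ?O" by (rule finite_subset[of _ "J \<times> J"]) (use J in auto)
    have fA: "finite {(i, j). i \<in> J \<and> j \<in> J \<and> d i j \<le> 2 * t}"
      by (rule finite_subset[of _ "J \<times> J"]) (use J in auto)
    have "2 * card {{i, j} |i j. i \<in> J \<and> j \<in> J \<and> i \<noteq> j \<and> B i \<inter> B j \<noteq> {}} \<le> card ?O"
      using J by (intro card_offdiagonal_pairs) auto
    then have "\<alpha> * (2 * real (m choose 2)) \<le> real (card ?O)"
      using hyp by linarith
    moreover have "2 * real (m choose 2) = real m * (real m - 1)"
    proof -
      have "even (m * (m - 1))" by (cases m) auto
      then have "2 * (m choose 2) = m * (m - 1)"
        unfolding choose_two by (rule dvd_mult_div_cancel)
      then show ?thesis using assms(2) by (metis of_nat_1 of_nat_diff of_nat_mult of_nat_numeral)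
    qed
    ultimately have "\<alpha> * (real m * (real m - 1)) \<le> real (card ?O)"
      by simp
    moreover have "\<alpha> * real m \<le> real m" using \<alpha>(2) by (simp add: mult_left_le_one_le \<alpha>0)
    ultimately have "\<alpha> * real m * real m \<le> real (card ?O) + real m"
      by (simp add: algebra_simps)
    also have "\<dots> = real (card (?O \<union> (\<lambda>i. (i, i)) ` J))"
      using fO J by (subst card_Un_disjoint) (auto simp: card_image inj_on_def)
    also have "\<dots> \<le> real (card {(i, j). i \<in> J \<and> j \<in> J \<and> d i j \<le> 2 * t})"
      using Bd fA by (intro of_nat_mono card_mono) (auto simp: d_def)
    finally show ?thesis using J by simp
  qed
  define Ch where "Ch = {(u, v, w). u \<in> J \<and> v \<in> J \<and> w \<in> J \<and> d u v \<le> 2 * t \<and> d u w \<le> 2 * t}"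
  have Ch: "(\<alpha> * real m)\<^sup>2 * real m \<le> real (card Ch)"
    using card_cherries_ge[OF J(1) deg] \<alpha>0 J by (simp add: Ch_def)
  define far where "far = (\<lambda>x y z. d x y \<le> d y z \<and> d x z \<le> d y z \<and> d x y \<le> 2 * t \<and> d x z \<le> 2 * t)"
  define Q where "Q = {(x, y, z). x \<in> J \<and> y \<in> J \<and> z \<in> J \<and> far x y z}"
  have fQ: "finite Q" by (rule finite_subset[of _ "J \<times> J \<times> J"]) (use J in \<open>auto simp: Q_def\<close>)
  \<comment> \<open>Some side of the triangle is longest, and the vertex opposite to it plays the
    role of \<open>x\<close> in \<open>far\<close>. The two other sides are at most
    \<open>2 t\<close>: either they are the sides at the apex, or the longest side is one of those
    and bounds all three. The three images undo the renaming of vertices.\<close>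
  have "Ch \<subseteq> Q \<union> ((\<lambda>(x, y, z). (y, x, z)) ` Q \<union> (\<lambda>(x, y, z). (y, z, x)) ` Q)"
  proof
    fix x assume "x \<in> Ch"
    moreover obtain u v w where x: "x = (u, v, w)" by (rule prod_cases3)
    ultimately have uvw: "(u, v, w) \<in> Ch" by simp
    then have "far u v w \<or> far v u w \<or> far w u v"
      using dsym[of v u] dsym[of w u] dsym[of w v] by (auto simp: far_def Ch_def)
    then have "(u, v, w) \<in> Q \<or> (v, u, w) \<in> Q \<or> (w, u, v) \<in> Q"
      using uvw by (auto simp: Q_def Ch_def)
    then show "x \<in> Q \<union> ((\<lambda>(x, y, z). (y, x, z)) ` Q \<union> (\<lambda>(x, y, z). (y, z, x)) ` Q)"
      unfolding x by force
  qed
  then have "card Ch \<le> card Q + card ((\<lambda>(x, y, z). (y, x, z)) ` Q \<union> (\<lambda>(x, y, z). (y, z, x)) ` Q)"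
    using fQ by (intro card_split_le) auto
  also have "\<dots> \<le> card Q + (card Q + card Q)"
    using fQ by (intro add_left_mono order_trans[OF card_Un_le] add_mono card_image_le)
  finally have ChQ: "card Ch \<le> 3 * card Q" by simp
  have "1 \<in> {1..m}" using assms(2) by simp
  then have "{..<n} \<rightarrow>\<^sub>E X \<noteq> {}" using a by blast
  then obtain p where p: "p \<in> {..<n} \<rightarrow>\<^sub>E X"
    and max: "\<forall>q \<in> {..<n} \<rightarrow>\<^sub>E X. card {i \<in> J. q \<in> B i} \<le> card {i \<in> J. p \<in> B i}"
    by (rule obtain_most_covering_point[where B = B, OF J(1)])
  define M where "M = card {i \<in> J. p \<in> B i}"
  define C where "C = ((4 * t) choose t) * (card X ^ t * M)"
  \<comment> \<open>One third point already forces \<open>d y z \<le> 4 * t\<close>, by the triangle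
    inequality through it; without any there is nothing to count.\<close>
  have third: "card {x \<in> J. far x y z} \<le> C" if "y \<in> J" "z \<in> J" for y z
  proof (cases "{x \<in> J. far x y z} = {}")
    case False
    then obtain x where x: "d x y \<le> 2 * t" "d x z \<le> 2 * t" by (auto simp: far_def)
    then have "d y z \<le> 4 * t"
      using hamming_dist_triangle[of n "a y" "a z" "a x"] dsym[of x y] by (simp add: d_def)
    then have dyz: "hamming_dist n (a y) (a z) \<le> 4 * t" by (simp add: d_def)
    have aJ: "a i \<in> {..<n} \<rightarrow>\<^sub>E X" if "i \<in> J" for i using a that by (simp add: J_def)
    have "card {i \<in> J. q \<in> hamming_ball n X t (a i)} \<le> M" if "q \<in> {..<n} \<rightarrow>\<^sub>E X" for q
      using max that by (simp add: M_def B_def)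
    from card_third_points_le[OF X assms(1) J(1) aJ aJ[OF \<open>y \<in> J\<close>] dyz this]
    show ?thesis by (simp add: far_def d_def C_def)
  next
    case True
    then show ?thesis by (simp only: card.empty le0)
  qed
  have "Q \<subseteq> (\<Union>(y, z)\<in>J \<times> J. (\<lambda>x. (x, y, z)) ` {x \<in> J. far x y z})"
    by (auto simp: Q_def)
  then have "card Q \<le> card (J \<times> J) * C"
  proof (rule card_le_cover)
    fix b assume "b \<in> J \<times> J"
    then show "finite (case b of (y, z) \<Rightarrow> (\<lambda>x. (x, y, z)) ` {x \<in> J. far x y z}) \<and>
        card (case b of (y, z) \<Rightarrow> (\<lambda>x. (x, y, z)) ` {x \<in> J. far x y z}) \<le> C"
      using J third by (auto simp: card_image inj_on_def)
  qed (use J in auto)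
  then have "card Ch \<le> 3 * (m * m * C)"
    using ChQ J by (simp add: card_cartesian_product)
  then have "(\<alpha> * real m)\<^sup>2 * real m \<le> real (3 * (m * m * C))"
    using Ch by linarith
  then have "\<alpha>\<^sup>2 * real m * (real m * real m) \<le> 3 * real C * (real m * real m)"
    by (simp add: power2_eq_square algebra_simps)
  then have *: "\<alpha>\<^sup>2 * real m \<le> 3 * real C" using assms(2) by simp
  have pos: "0 < real (card X) ^ t" "0 < real ((4 * t) choose t)"
    using X assms(1) by (auto simp: card_gt_0_iff)
  \<comment> \<open>The count yields the factor 3; it is relaxed to 4 so that both properties share
    one constant.\<close>
  have "\<alpha>\<^sup>2 * real m \<le> 4 * real C" using * by linarith
  then have "\<alpha>\<^sup>2 * real m \<le> 4 * (real ((4 * t) choose t) * (real (card X) ^ t * real M))"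
    by (simp add: C_def)
  then have "1/4 * \<alpha>\<^sup>2 * (1 / real (card X) ^ t) * (1 / real ((4 * t) choose t)) * real m \<le> real M"
    using pos by (simp add: field_simps)
  then show "\<exists>p\<in>{..<n} \<rightarrow>\<^sub>E X. 1/4 * \<alpha>\<^sup>2 * (1 / real (card X) ^ t) * (1 / real ((4 * t) choose t)) * real m
      \<le> real (card {i \<in> {1..m}. p \<in> hamming_ball n X t (a i)})"
    using p unfolding M_def B_def J_def by blast
qed

subsection \<open>Intersecting subfamilies of size $t + 2$\<close>

definition far_indices :: "nat \<Rightarrow> nat \<Rightarrow> (nat \<Rightarrow> nat \<Rightarrow> 'a) \<Rightarrow> nat set \<Rightarrow> (nat \<Rightarrow> 'a) \<Rightarrow> nat set" where
  "far_indices n t a T q = {i \<in> T. t < hamming_dist n q (a i)}"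

text \<open>The choice depends on the two points but not on the index set, so searches over
  different index sets that consult the same centre at the same point branch in the same
  way.\<close>

definition branch_coords :: "nat \<Rightarrow> nat \<Rightarrow> (nat \<Rightarrow> 'a) \<Rightarrow> (nat \<Rightarrow> 'a) \<Rightarrow> nat set" where
  "branch_coords n t q b = (SOME C. C \<subseteq> {k. k < n \<and> q k \<noteq> b k} \<and> card C = t + 1)"

lemma branch_coords:
  assumes "t < hamming_dist n q b"
  shows "branch_coords n t q b \<subseteq> {k. k < n \<and> q k \<noteq> b k}" "card (branch_coords n t q b) = t + 1"
proof -
  have "t + 1 \<le> card {k. k < n \<and> q k \<noteq> b k}"
    using assms by (simp add: hamming_dist_def)
  then obtain C where "C \<subseteq> {k. k < n \<and> q k \<noteq> b k}" "card C = t + 1" "finite C"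
    by (rule obtain_subset_with_card_n)
  then have "\<exists>C. C \<subseteq> {k. k < n \<and> q k \<noteq> b k} \<and> card C = t + 1" by blast
  from someI_ex[OF this] show "branch_coords n t q b \<subseteq> {k. k < n \<and> q k \<noteq> b k}"
    "card (branch_coords n t q b) = t + 1" by (simp_all add: branch_coords_def)
qed

text \<open>A search tree of depth \<open>s\<close>: each level moves \<open>q\<close> onto the
  violated centre of least index, in one of \<open>t + 1\<close> coordinates. Taking the least index
  keeps the selection unchanged when the index set shrinks but retains the selected index.\<close>

primrec reach :: "nat \<Rightarrow> nat \<Rightarrow> (nat \<Rightarrow> nat \<Rightarrow> 'a) \<Rightarrow> nat set \<Rightarrow> nat \<Rightarrow> (nat \<Rightarrow> 'a) \<Rightarrow> (nat \<Rightarrow> 'a) set" where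
  "reach n t a T 0 q = {q}"
| "reach n t a T (Suc s) q =
    (if far_indices n t a T q = {} then {q}
     else let i = Min (far_indices n t a T q) in
       \<Union>k\<in>branch_coords n t q (a i). reach n t a T s (q(k := a i k)))"

lemma Min_far_indices:
  assumes "finite T" "far_indices n t a T q \<noteq> {}"
  shows "Min (far_indices n t a T q) \<in> T"
    "t < hamming_dist n q (a (Min (far_indices n t a T q)))"
proof -
  have "Min (far_indices n t a T q) \<in> far_indices n t a T q"
    using assms by (intro Min_in) (auto simp: far_indices_def)
  then show "Min (far_indices n t a T q) \<in> T"
    "t < hamming_dist n q (a (Min (far_indices n t a T q)))"
    by (auto simp: far_indices_def)
qed

lemma card_reach:
  assumes "finite T"
  shows "finite (reach n t a T s q) \<and> card (reach n t a T s q) \<le> (t + 1) ^ s"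
proof (induction s arbitrary: q)
  case (Suc s)
  show ?case
  proof (cases "far_indices n t a T q = {}")
    case False
    define i where "i = Min (far_indices n t a T q)"
    have bc: "card (branch_coords n t q (a i)) = t + 1"
      unfolding i_def by (rule branch_coords(2)[OF Min_far_indices(2)[OF assms False]])
    then have fin: "finite (branch_coords n t q (a i))" by (simp add: card_ge_0_finite)
    have eq: "reach n t a T (Suc s) q =
        (\<Union>k\<in>branch_coords n t q (a i). reach n t a T s (q(k := a i k)))"
      using False by (simp add: i_def Let_def)
    have "card (reach n t a T (Suc s) q) \<le> card (branch_coords n t q (a i)) * (t + 1) ^ s"
      unfolding eq by (rule card_le_cover[OF subset_refl fin Suc.IH])
    then show ?thesis unfolding bc using eq fin Suc.IH by auto
  next
    case True
    have "1 \<le> (t + 1) ^ Suc s" by (rule one_le_power) simp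
    then show ?thesis using True by simp
  qed
qed simp

lemma reach_subset:
  assumes "finite T" "\<And>i. i \<in> T \<Longrightarrow> a i \<in> {..<n} \<rightarrow>\<^sub>E X" "q \<in> {..<n} \<rightarrow>\<^sub>E X"
  shows "reach n t a T s q \<subseteq> {..<n} \<rightarrow>\<^sub>E X"
  using assms(3)
proof (induction s arbitrary: q)
  case (Suc s)
  show ?case
  proof (cases "far_indices n t a T q = {}")
    case False
    define i where "i = Min (far_indices n t a T q)"
    have i: "i \<in> T" "t < hamming_dist n q (a i)"
      unfolding i_def using Min_far_indices[OF assms(1) False] by auto
    have "q(k := a i k) \<in> {..<n} \<rightarrow>\<^sub>E X" if "k \<in> branch_coords n t q (a i)" for k
      using that branch_coords(1)[OF i(2)] assms(2)[OF i(1)] Suc.prems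
      by (auto simp: PiE_iff extensional_def)
    then have "(\<Union>k\<in>branch_coords n t q (a i). reach n t a T s (q(k := a i k))) \<subseteq> {..<n} \<rightarrow>\<^sub>E X"
      using Suc.IH by blast
    then show ?thesis using False by (simp add: i_def Let_def)
  qed (use Suc.prems in simp)
qed simp

text \<open>If \<open>p\<close> lies in the ball around \<open>a i\<close> and \<open>q\<close> does not, then \<open>p\<close> agrees with \<open>a i\<close> on one of
  any \<open>t + 1\<close> coordinates where \<open>q\<close> differs from \<open>a i\<close>; correcting \<open>q\<close> there brings it closer to
  \<open>p\<close>. The set \<open>S\<close> collects the indices consulted on the way, so that running the procedure on any
  \<open>T\<close> between \<open>S\<close> and \<open>I\<close> makes the same choices as running it on \<open>I\<close>.\<close>

lemma reach_common_point:
  assumes "finite I" "\<forall>i\<in>I. hamming_dist n p (a i) \<le> t" "hamming_dist n q p \<le> s"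
  shows "\<exists>S \<subseteq> I. card S \<le> s \<and> (\<forall>T. S \<subseteq> T \<longrightarrow> T \<subseteq> I \<longrightarrow>
    (\<exists>r\<in>reach n t a T s q. \<forall>i\<in>I. hamming_dist n r (a i) \<le> t))"
  using assms(3)
proof (induction s arbitrary: q)
  case 0
  \<comment> \<open>Distance 0 means agreement only below \<open>n\<close>, which is all that the
    distances see. So \<open>q\<close> itself is a common point and no index is consulted.\<close>
  then have "{k. k < n \<and> q k \<noteq> p k} = {}" by (simp add: hamming_dist_def)
  then have "q k = p k" if "k < n" for k using that by blast
  then have "hamming_dist n q (a i) = hamming_dist n p (a i)" for i
    by (rule hamming_dist_cong)
  then show ?case using assms(2) by (intro exI[of _ "{}"]) auto
next
  case (Suc s)
  show ?case
  proof (cases "far_indices n t a I q = {}")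
    case True
    then have far: "far_indices n t a T q = {}" if "T \<subseteq> I" for T
      using that by (auto simp: far_indices_def)
    have "\<forall>i\<in>I. hamming_dist n q (a i) \<le> t" using True by (auto simp: far_indices_def not_less)
    then show ?thesis using far by (intro exI[of _ "{}"]) auto
  next
    case False
    define i where "i = Min (far_indices n t a I q)"
    have i: "i \<in> I" "t < hamming_dist n q (a i)"
      unfolding i_def using Min_far_indices[OF assms(1) False] by auto
    note bc = branch_coords[OF i(2)]
    obtain k where k: "k \<in> branch_coords n t q (a i)" "p k = a i k"
    proof (rule ccontr)
      assume "\<not> thesis"
      then have "branch_coords n t q (a i) \<subseteq> {k. k < n \<and> p k \<noteq> a i k}" using that bc by blast
      then have "t + 1 \<le> hamming_dist n p (a i)"
        unfolding hamming_dist_def bc(2)[symmetric] by (intro card_mono) auto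
      then show False using assms(2) i(1) by force
    qed
    define q' where "q' = q(k := a i k)"
    have kq: "k \<in> {k. k < n \<and> q k \<noteq> p k}" using k bc by auto
    have "{k. k < n \<and> q' k \<noteq> p k} = {k. k < n \<and> q k \<noteq> p k} - {k}"
      using k by (auto simp: q'_def)
    then have "hamming_dist n q' p \<le> s"
      using Suc.prems kq by (simp add: hamming_dist_def)
    from Suc.IH[OF this] obtain S where S: "S \<subseteq> I" "card S \<le> s"
      and reach: "\<forall>T. S \<subseteq> T \<longrightarrow> T \<subseteq> I \<longrightarrow>
        (\<exists>r\<in>reach n t a T s q'. \<forall>i\<in>I. hamming_dist n r (a i) \<le> t)"
      by (elim exE conjE)
    have "\<exists>r\<in>reach n t a T (Suc s) q. \<forall>i\<in>I. hamming_dist n r (a i) \<le> t"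
      if T: "insert i S \<subseteq> T" "T \<subseteq> I" for T
    proof -
      have iT: "i \<in> far_indices n t a T q" using T i by (auto simp: far_indices_def)
      have sub: "far_indices n t a T q \<subseteq> far_indices n t a I q" and fin: "finite (far_indices n t a I q)"
        using T assms(1) by (auto simp: far_indices_def)
      \<comment> \<open>The far indices in \<open>T\<close> are among those in \<open>I\<close>, of
        which \<open>i\<close> is the least, and \<open>i\<close> is still present.\<close>
      have "Min (far_indices n t a T q) = i"
      proof (rule antisym)
        show "Min (far_indices n t a T q) \<le> i"
          using iT finite_subset[OF sub fin] by (rule Min_le[rotated])
        show "i \<le> Min (far_indices n t a T q)"
          unfolding i_def using iT sub fin by (intro Min_antimono) auto
      qed
      then have sub: "reach n t a T s q' \<subseteq> reach n t a T (Suc s) q"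
        using iT k(1) by (auto simp: q'_def Let_def)
      have "\<exists>r\<in>reach n t a T s q'. \<forall>i\<in>I. hamming_dist n r (a i) \<le> t"
        using reach T by simp
      with sub show ?thesis by (meson subsetD)
    qed
    then have "\<forall>T. insert i S \<subseteq> T \<longrightarrow> T \<subseteq> I \<longrightarrow>
        (\<exists>r\<in>reach n t a T (Suc s) q. \<forall>i\<in>I. hamming_dist n r (a i) \<le> t)" by blast
    moreover have "card (insert i S) \<le> Suc s" using S(2) by (cases "finite S") (auto simp: card_insert_if)
    moreover have "insert i S \<subseteq> I" using S(1) i(1) by blast
    ultimately show ?thesis by blast
  qed
qed

section \<open>Encoding and counting the intersecting subfamilies\<close>

text \<open>An intersecting \<open>I\<close> is encoded by a subset \<open>T\<close> of size
  \<open>t + 1\<close>, a candidate \<open>r\<close> reached from \<open>T\<close> alone, and the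
  one index \<open>j\<close> of \<open>I\<close> outside \<open>T\<close>. Since \<open>r\<close>
  lies in all balls of \<open>I\<close>, it lies in the ball of \<open>j\<close>, which leaves at
  most \<open>M\<close> values of \<open>j\<close>.\<close>

lemma card_intersecting_subsets_le:
  fixes a :: "nat \<Rightarrow> nat \<Rightarrow> 'a"
  assumes "finite J" and a: "\<And>i. i \<in> J \<Longrightarrow> a i \<in> {..<n} \<rightarrow>\<^sub>E X"
    and M: "\<And>p. p \<in> {..<n} \<rightarrow>\<^sub>E X \<Longrightarrow> card {i \<in> J. p \<in> hamming_ball n X t (a i)} \<le> M"
  shows "card {I. I \<subseteq> J \<and> card I = t + 2 \<and> (\<Inter>i\<in>I. hamming_ball n X t (a i)) \<noteq> {}}
    \<le> (card J choose (t + 1)) * ((t + 1) ^ t * M)" (is "card ?F \<le> _")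
proof -
  define cov where "cov = (\<lambda>p. {i \<in> J. p \<in> hamming_ball n X t (a i)})"
  define \<T> where "\<T> = {T. T \<subseteq> J \<and> card T = t + 1}"
  have f\<T>: "finite \<T>" "card \<T> = card J choose (t + 1)"
    unfolding \<T>_def using assms(1) n_subsets[of J "t + 1"] by auto
  have \<T>: "finite T" "reach n t a T s (a (Min T)) \<subseteq> {..<n} \<rightarrow>\<^sub>E X" if "T \<in> \<T>" for T s
  proof -
    have T: "T \<subseteq> J" "card T = t + 1" using that by (auto simp: \<T>_def)
    then show "finite T" using assms(1) finite_subset by blast
    then have "Min T \<in> T" using T by (intro Min_in) auto
    then show "reach n t a T s (a (Min T)) \<subseteq> {..<n} \<rightarrow>\<^sub>E X"
      using T a by (intro reach_subset \<open>finite T\<close>) auto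
  qed
  have "?F \<subseteq> (\<Union>T\<in>\<T>. \<Union>r\<in>reach n t a T t (a (Min T)). (\<lambda>j. insert j T) ` cov r)"
  proof
    fix I assume I': "I \<in> ?F"
    then have I: "I \<subseteq> J" "card I = t + 2" "finite I" "I \<noteq> {}"
      using rev_finite_subset[OF assms(1), of I] by auto
    obtain p where p: "\<And>i. i \<in> I \<Longrightarrow> p \<in> hamming_ball n X t (a i)" using I' by auto
    have dist: "\<forall>i\<in>I. hamming_dist n p (a i) \<le> t"
      using p by (auto simp: hamming_ball_def)
    define q where "q = a (Min I)"
    have min: "Min I \<in> I" using I by simp
    have "hamming_dist n q p \<le> t"
      using bspec[OF dist min] by (simp add: q_def hamming_dist_commute)
    from reach_common_point[OF I(3) dist this] obtain S where S: "S \<subseteq> I" "card S \<le> t"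
      and reach: "\<forall>T. S \<subseteq> T \<longrightarrow> T \<subseteq> I \<longrightarrow>
        (\<exists>r\<in>reach n t a T t q. \<forall>i\<in>I. hamming_dist n r (a i) \<le> t)"
      by (elim exE conjE)
    \<comment> \<open>Depth \<open>t\<close> suffices when the search starts at a centre. The start
      also counts as consulted, so \<open>T\<close> must hold \<open>t + 1\<close> indices, one
      fewer than \<open>I\<close>.\<close>
    have "card (insert (Min I) S) \<le> t + 1"
      using S I by (simp add: card_insert_if finite_subset)
    then obtain T where T: "insert (Min I) S \<subseteq> T" "T \<subseteq> I" "card T = t + 1"
      using obtain_superset_card[of "insert (Min I) S" I "t + 1"] S min I by auto
    have "finite T" using T(2) I(3) by (rule finite_subset)
    \<comment> \<open>The starting centre must be recoverable from \<open>T\<close>, since the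
      covering union does not know \<open>I\<close>.\<close>
    have "Min T = Min I"
    proof (rule antisym)
      show "Min T \<le> Min I" using T(1) \<open>finite T\<close> by simp
      show "Min I \<le> Min T" using T I by (intro Min_antimono) auto
    qed
    moreover have "\<exists>r\<in>reach n t a T t q. \<forall>i\<in>I. hamming_dist n r (a i) \<le> t"
      using reach T(1,2) by simp
    ultimately obtain r where r: "r \<in> reach n t a T t (a (Min T))" "\<forall>i\<in>I. hamming_dist n r (a i) \<le> t"
      unfolding q_def by auto
    have T\<T>: "T \<in> \<T>" using T I by (auto simp: \<T>_def)
    have "card (I - T) = 1" using T I \<open>finite T\<close> by (simp add: card_Diff_subset)
    then obtain j where j: "I - T = {j}" by (auto simp: card_1_singleton_iff)
    then have "I = insert j T" using T by auto
    moreover have "r \<in> {..<n} \<rightarrow>\<^sub>E X" using r(1) \<T>(2)[OF T\<T>] by blast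
    then have "j \<in> cov r"
      using j r(2) I by (auto simp: cov_def hamming_ball_def)
    ultimately show "I \<in> (\<Union>T\<in>\<T>. \<Union>r\<in>reach n t a T t (a (Min T)). (\<lambda>j. insert j T) ` cov r)"
      using T\<T> r(1) by blast
  qed
  moreover have "finite (\<Union>r\<in>reach n t a T t (a (Min T)). (\<lambda>j. insert j T) ` cov r) \<and>
      card (\<Union>r\<in>reach n t a T t (a (Min T)). (\<lambda>j. insert j T) ` cov r) \<le> (t + 1) ^ t * M"
    if T: "T \<in> \<T>" for T
  proof -
    have fcov: "finite (cov r)" for r using assms(1) by (simp add: cov_def)
    note c = card_reach[OF \<T>(1)[OF T], of n t a t "a (Min T)"]
    have "card ((\<lambda>j. insert j T) ` cov r) \<le> M" if "r \<in> reach n t a T t (a (Min T))" for r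
      using card_image_le[OF fcov, of "\<lambda>j. insert j T" r] M[of r] \<T>(2)[OF T] that
      by (force simp: cov_def)
    then have "card (\<Union>r\<in>reach n t a T t (a (Min T)). (\<lambda>j. insert j T) ` cov r)
        \<le> card (reach n t a T t (a (Min T))) * M"
      using c fcov by (intro card_le_cover[OF subset_refl]) auto
    also have "\<dots> \<le> (t + 1) ^ t * M" using c by simp
    finally show ?thesis using c fcov by auto
  qed
  ultimately have "card ?F \<le> card \<T> * ((t + 1) ^ t * M)"
    by (rule card_le_cover[OF _ f\<T>(1)])
  then show ?thesis by (simp only: f\<T>(2))
qed

lemma subsets_property_fourth:
  fixes X :: "'a set"
  assumes "1 \<le> m" and a: "\<And>i. i \<in> {1..m} \<Longrightarrow> a i \<in> {..<n} \<rightarrow>\<^sub>E X"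
  shows "subsets_property (1/4) m n t X a"
  unfolding subsets_property_def Let_def
proof (intro impI allI)
  fix \<alpha> :: real
  assume \<alpha>: "0 < \<alpha>" "\<alpha> \<le> 1" and hyp: "\<alpha> * real (m choose (t + 2))
    \<le> real (card {I. I \<subseteq> {1..m} \<and> card I = t + 2 \<and> (\<Inter>i\<in>I. hamming_ball n X t (a i)) \<noteq> {}})"
  define B where "B = (\<lambda>i. hamming_ball n X t (a i))"
  define J where "J = {1..m}"
  have J: "finite J" by (simp add: J_def)
  have a1: "a 1 \<in> {..<n} \<rightarrow>\<^sub>E X" using a assms(1) by simp
  then have "{..<n} \<rightarrow>\<^sub>E X \<noteq> {}" by blast
  then obtain p where p: "p \<in> {..<n} \<rightarrow>\<^sub>E X" and max': "\<forall>q \<in> {..<n} \<rightarrow>\<^sub>E X.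
      card {i \<in> J. q \<in> B i} \<le> card {i \<in> J. p \<in> B i}"
    by (rule obtain_most_covering_point[where B = B, OF J])
  note max = max'[unfolded B_def J_def, THEN bspec]
  define M where "M = card {i \<in> {1..m}. p \<in> hamming_ball n X t (a i)}"
  define s where "s = real (t + 1)"
  have s: "1 \<le> s" by (simp add: s_def)
  have es: "s ^ (t + 1) \<le> (exp 1 * s) ^ (t + 1)"
    using s by (intro power_mono) auto
  have "\<alpha> * real m \<le> 4 * s ^ (t + 1) * real M"
  \<comment> \<open>For small \<open>m\<close> a single ball is enough:
    \<open>m \<le> 2 t + 3 \<le> 4 s\<close>, and the centre \<open>a 1\<close> lies in its own
    ball. For larger \<open>m\<close> the count of subfamilies applies.\<close>
  proof (cases "m < 2 * (t + 2)")
    case True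
    have "{1} \<subseteq> {i \<in> {1..m}. a 1 \<in> hamming_ball n X t (a i)}"
      using a1 assms(1) by (simp add: hamming_ball_def)
    then have "card {1::nat} \<le> card {i \<in> {1..m}. a 1 \<in> hamming_ball n X t (a i)}"
      by (intro card_mono) simp_all
    then have M1: "1 \<le> real M" using max[OF a1] by (simp add: M_def)
    have "\<alpha> * real m \<le> real m" using \<alpha> by (simp add: mult_left_le_one_le)
    also have "\<dots> \<le> 4 * s" using True by (simp add: s_def)
    also have "\<dots> \<le> 4 * s ^ (t + 1) * 1" using power_increasing[of 1 "t + 1" s] s by simp
    also have "\<dots> \<le> 4 * s ^ (t + 1) * real M"
      using s M1 by (intro mult_left_mono) auto
    finally show ?thesis .
  next
    case False
    define C where "C = m choose (t + 1)"
    have C: "0 < real C" using False by (simp add: C_def)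
    have "card {I. I \<subseteq> {1..m} \<and> card I = t + 2 \<and> (\<Inter>i\<in>I. hamming_ball n X t (a i)) \<noteq> {}}
      \<le> C * ((t + 1) ^ t * M)"
      using card_intersecting_subsets_le[of "{1..m}" a n X t M] a max by (simp add: M_def C_def)
    then have "\<alpha> * real (m choose (t + 2)) \<le> real C * (s ^ t * real M)"
      using hyp unfolding s_def by (smt (verit) of_nat_le_iff of_nat_mult of_nat_power)
    then have 1: "\<alpha> * (real (t + 2) * real (m choose (t + 2))) \<le> real (t + 2) * (real C * (s ^ t * real M))"
      using mult_left_mono[of _ _ "real (t + 2)"] by (metis mult.left_commute of_nat_0_le_iff)
    \<comment> \<open>This identity turns the quotient of the two binomial coefficients into
      \<open>(m - (t + 1)) / (t + 2)\<close>.\<close>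
    have "(t + 2) * (m choose (t + 2)) = (m - (t + 1)) * C"
      using binomial_absorb_comp[of m "t + 1"] binomial_absorption[of "t + 1" m]
      by (simp add: C_def)
    then have "real (t + 2) * real (m choose (t + 2)) = real (m - (t + 1)) * real C"
      by (metis of_nat_mult)
    then have "\<alpha> * real (m - (t + 1)) * real C \<le> real (t + 2) * (s ^ t * real M) * real C"
      using 1 by (simp add: algebra_simps)
    then have 2: "\<alpha> * real (m - (t + 1)) \<le> real (t + 2) * (s ^ t * real M)"
      using C by simp
    \<comment> \<open>The factor 4 is made of two factors 2: \<open>m \<le> 2 (m - (t + 1))\<close>
      in this case, and \<open>t + 2 \<le> 2 s\<close> below.\<close>
    have "\<alpha> * real m \<le> \<alpha> * (2 * real (m - (t + 1)))"
      using False \<alpha> by (intro mult_left_mono) auto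
    also have "\<dots> \<le> 2 * (real (t + 2) * (s ^ t * real M))" using 2 by simp
    also have "\<dots> \<le> 2 * ((2 * s) * (s ^ t * real M))"
      using s by (intro mult_left_mono mult_right_mono) (auto simp: s_def)
    finally show ?thesis by (simp add: algebra_simps)
  qed
  also have "\<dots> \<le> 4 * (exp 1 * s) ^ (t + 1) * real M"
    using es by (intro mult_right_mono mult_left_mono) auto
  finally have "1/4 * \<alpha> * real m / (exp 1 * s) ^ (t + 1) \<le> real M"
    using s by (simp add: pos_divide_le_eq algebra_simps)
  then show "\<exists>p\<in>{..<n} \<rightarrow>\<^sub>E X. 1/4 * \<alpha> * real m / (exp 1 * real (t + 1)) ^ (t + 1)
      \<le> real (card {i \<in> {1..m}. p \<in> hamming_ball n X t (a i)})"
    using p unfolding M_def s_def by blast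
qed

subsection \<open>Independence of the alphabet type\<close>

text \<open>The restriction makes the result undefined outside the \<open>n\<close> coordinates, as
  membership in an extensional function space demands.\<close>

definition relabel :: "nat \<Rightarrow> ('a \<Rightarrow> 'b) \<Rightarrow> (nat \<Rightarrow> 'a) \<Rightarrow> nat \<Rightarrow> 'b" where
  "relabel n f p = restrict (f \<circ> p) {..<n}"

lemma relabel_image:
  "relabel n f ` ({..<n} \<rightarrow>\<^sub>E X) = {..<n} \<rightarrow>\<^sub>E f ` X"
proof (intro equalityI subsetI)
  fix p assume p: "p \<in> {..<n} \<rightarrow>\<^sub>E f ` X"
  then have "\<forall>k\<in>{..<n}. \<exists>x\<in>X. p k = f x" by (auto simp: PiE_iff)
  then obtain g where g: "\<And>k. k < n \<Longrightarrow> g k \<in> X \<and> p k = f (g k)" by (metis lessThan_iff)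
  have "p = relabel n f (restrict g {..<n})"
    using p g by (auto simp: relabel_def fun_eq_iff PiE_iff extensional_def restrict_def)
  then show "p \<in> relabel n f ` ({..<n} \<rightarrow>\<^sub>E X)" using g by auto
qed (auto simp: relabel_def PiE_iff)

lemma hamming_dist_relabel:
  assumes "inj_on f X" "p \<in> {..<n} \<rightarrow>\<^sub>E X" "q \<in> {..<n} \<rightarrow>\<^sub>E X"
  shows "hamming_dist n (relabel n f p) (relabel n f q) = hamming_dist n p q"
  unfolding hamming_dist_def using assms
  by (intro arg_cong[where f = card]) (auto simp: relabel_def PiE_iff inj_on_def)

lemma relabel_mem_hamming_ball:
  assumes "inj_on f X" "p \<in> {..<n} \<rightarrow>\<^sub>E X" "x \<in> {..<n} \<rightarrow>\<^sub>E X"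
  shows "relabel n f p \<in> hamming_ball n (f ` X) t (relabel n f x) \<longleftrightarrow> p \<in> hamming_ball n X t x"
proof -
  have "relabel n f p \<in> {..<n} \<rightarrow>\<^sub>E f ` X"
    unfolding relabel_image[symmetric] using assms(2) by (rule imageI)
  then show ?thesis
    unfolding hamming_ball_def using assms(2) hamming_dist_relabel[OF assms] by simp
qed

text \<open>Any one ball confines the common points to the Hamming space; over an empty
  \<open>I\<close> the intersection would be the whole function type.\<close>

lemma balls_meet_iff:
  assumes "I \<noteq> {}"
  shows "(\<Inter>i\<in>I. hamming_ball n X t (a i)) \<noteq> {} \<longleftrightarrow>
    (\<exists>p \<in> {..<n} \<rightarrow>\<^sub>E X. \<forall>i\<in>I. p \<in> hamming_ball n X t (a i))"
proof -
  obtain i where "i \<in> I" using assms by blast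
  moreover have "hamming_ball n X t (a i) \<subseteq> {..<n} \<rightarrow>\<^sub>E X"
    by (simp add: hamming_ball_def)
  moreover have "(\<Inter>i\<in>I. hamming_ball n X t (a i)) \<noteq> {} \<longleftrightarrow> (\<exists>p. \<forall>i\<in>I. p \<in> hamming_ball n X t (a i))"
    by (simp add: ex_in_conv[symmetric])
  ultimately show ?thesis by (meson subsetD)
qed

lemma balls_meet_relabel:
  assumes "inj_on f X" "\<forall>i\<in>I. a i \<in> {..<n} \<rightarrow>\<^sub>E X" "I \<noteq> {}"
  shows "(\<Inter>i\<in>I. hamming_ball n (f ` X) t (relabel n f (a i))) \<noteq> {} \<longleftrightarrow>
    (\<Inter>i\<in>I. hamming_ball n X t (a i)) \<noteq> {}"
proof -
  have "(\<Inter>i\<in>I. hamming_ball n (f ` X) t (relabel n f (a i))) \<noteq> {} \<longleftrightarrow>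
      (\<exists>p \<in> {..<n} \<rightarrow>\<^sub>E f ` X. \<forall>i\<in>I. p \<in> hamming_ball n (f ` X) t (relabel n f (a i)))"
    using assms(3) by (rule balls_meet_iff)
  also have "\<dots> \<longleftrightarrow>
      (\<exists>p \<in> {..<n} \<rightarrow>\<^sub>E X. \<forall>i\<in>I. relabel n f p \<in> hamming_ball n (f ` X) t (relabel n f (a i)))"
    unfolding relabel_image[symmetric] by blast
  also have "\<dots> \<longleftrightarrow> (\<exists>p \<in> {..<n} \<rightarrow>\<^sub>E X. \<forall>i\<in>I. p \<in> hamming_ball n X t (a i))"
    by (intro bex_cong ball_cong refl relabel_mem_hamming_ball[OF assms(1)] bspec[OF assms(2)])
  also have "\<dots> \<longleftrightarrow> (\<Inter>i\<in>I. hamming_ball n X t (a i)) \<noteq> {}"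
    using assms(3) by (rule balls_meet_iff[symmetric])
  finally show ?thesis .
qed

lemma covering_point_relabel:
  assumes "inj_on f X" "\<And>i. i \<in> J \<Longrightarrow> a i \<in> {..<n} \<rightarrow>\<^sub>E X"
    and "\<exists>p \<in> {..<n} \<rightarrow>\<^sub>E f ` X. b \<le> real (card {i \<in> J. p \<in> hamming_ball n (f ` X) t (relabel n f (a i))})"
  shows "\<exists>p \<in> {..<n} \<rightarrow>\<^sub>E X. b \<le> real (card {i \<in> J. p \<in> hamming_ball n X t (a i)})"
proof -
  obtain p where p: "p \<in> {..<n} \<rightarrow>\<^sub>E X"
    "b \<le> real (card {i \<in> J. relabel n f p \<in> hamming_ball n (f ` X) t (relabel n f (a i))})"
    using assms(3) unfolding relabel_image[symmetric] by blast
  moreover have "{i \<in> J. relabel n f p \<in> hamming_ball n (f ` X) t (relabel n f (a i))} =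
      {i \<in> J. p \<in> hamming_ball n X t (a i)}"
    using relabel_mem_hamming_ball[OF assms(1) p(1)] assms(2) by blast
  ultimately show ?thesis by auto
qed

lemma pairs_property_relabel:
  assumes inj: "inj_on f X" and a: "\<And>i. i \<in> {1..m} \<Longrightarrow> a i \<in> {..<n} \<rightarrow>\<^sub>E X"
    and rel: "pairs_property c m n t (f ` X) (\<lambda>i. relabel n f (a i))"
  shows "pairs_property c m n t X a"
  unfolding pairs_property_def Let_def
proof (intro impI allI)
  fix \<alpha> :: real
  assume X: "finite X" and \<alpha>: "12 / real m < \<alpha>" "\<alpha> \<le> 1" and
    hyp: "\<alpha> * real (m choose 2) \<le> real (card {{i, j} |i j. i \<in> {1..m} \<and> j \<in> {1..m} \<and> i \<noteq> j \<and>
        hamming_ball n X t (a i) \<inter> hamming_ball n X t (a j) \<noteq> {}})"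
  have meet: "hamming_ball n (f ` X) t (relabel n f (a i)) \<inter> hamming_ball n (f ` X) t (relabel n f (a j)) \<noteq> {}
      \<longleftrightarrow> hamming_ball n X t (a i) \<inter> hamming_ball n X t (a j) \<noteq> {}"
    if "i \<in> {1..m}" "j \<in> {1..m}" for i j
  proof -
    have "\<forall>k\<in>{i, j}. a k \<in> {..<n} \<rightarrow>\<^sub>E X" using a that by blast
    from balls_meet_relabel[OF inj this, where t = t] show ?thesis by simp
  qed
  have "{{i, j} |i j. i \<in> {1..m} \<and> j \<in> {1..m} \<and> i \<noteq> j \<and>
        hamming_ball n (f ` X) t (relabel n f (a i)) \<inter> hamming_ball n (f ` X) t (relabel n f (a j)) \<noteq> {}}
      = {{i, j} |i j. i \<in> {1..m} \<and> j \<in> {1..m} \<and> i \<noteq> j \<and>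
        hamming_ball n X t (a i) \<inter> hamming_ball n X t (a j) \<noteq> {}}"
    by (intro Collect_cong ex_cong1 conj_cong refl meet)
  then have "\<exists>p \<in> {..<n} \<rightarrow>\<^sub>E f ` X.
      c * \<alpha>\<^sup>2 * (1 / real (card (f ` X)) ^ t) * (1 / real ((4 * t) choose t)) * real m
        \<le> real (card {i \<in> {1..m}. p \<in> hamming_ball n (f ` X) t (relabel n f (a i))})"
    using rel[unfolded pairs_property_def Let_def] X \<alpha> hyp by simp
  then have "\<exists>p \<in> {..<n} \<rightarrow>\<^sub>E X.
      c * \<alpha>\<^sup>2 * (1 / real (card (f ` X)) ^ t) * (1 / real ((4 * t) choose t)) * real m
        \<le> real (card {i \<in> {1..m}. p \<in> hamming_ball n X t (a i)})"
    by (intro covering_point_relabel[OF inj]) (use a in auto)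
  then show "\<exists>p \<in> {..<n} \<rightarrow>\<^sub>E X.
      c * \<alpha>\<^sup>2 * (1 / real (card X) ^ t) * (1 / real ((4 * t) choose t)) * real m
        \<le> real (card {i \<in> {1..m}. p \<in> hamming_ball n X t (a i)})"
    by (simp only: card_image[OF inj])
qed

text \<open>Passing from \<open>X\<close> to \<open>Y\<close> might destroy intersections;
  \<open>witness\<close> rules this out, so the counting hypothesis survives. On the way back, a
  point found over \<open>Y\<close> lies in at least as many balls over \<open>X\<close>.\<close>

lemma subsets_property_relabel:
  assumes inj: "inj_on f Y" and YX: "Y \<subseteq> X" and a: "\<And>i. i \<in> {1..m} \<Longrightarrow> a i \<in> {..<n} \<rightarrow>\<^sub>E Y"
    and witness: "\<And>I. I \<subseteq> {1..m} \<Longrightarrow> (\<Inter>i\<in>I. hamming_ball n X t (a i)) \<noteq> {} \<Longrightarrow>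
      (\<Inter>i\<in>I. hamming_ball n Y t (a i)) \<noteq> {}"
    and rel: "subsets_property c m n t (f ` Y) (\<lambda>i. relabel n f (a i))"
  shows "subsets_property c m n t X a"
  unfolding subsets_property_def Let_def
proof (intro impI allI)
  fix \<alpha> :: real
  assume \<alpha>: "0 < \<alpha>" "\<alpha> \<le> 1" and hyp: "\<alpha> * real (m choose (t + 2))
    \<le> real (card {I. I \<subseteq> {1..m} \<and> card I = t + 2 \<and> (\<Inter>i\<in>I. hamming_ball n X t (a i)) \<noteq> {}})"
  have "{I. I \<subseteq> {1..m} \<and> card I = t + 2 \<and> (\<Inter>i\<in>I. hamming_ball n X t (a i)) \<noteq> {}}
      \<subseteq> {I. I \<subseteq> {1..m} \<and> card I = t + 2 \<and>
          (\<Inter>i\<in>I. hamming_ball n (f ` Y) t (relabel n f (a i))) \<noteq> {}}" (is "?F \<subseteq> ?G")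
  proof
    fix I assume "I \<in> ?F"
    then have I: "I \<subseteq> {1..m}" "card I = t + 2" "(\<Inter>i\<in>I. hamming_ball n X t (a i)) \<noteq> {}"
      by blast+
    then have "I \<noteq> {}" by force
    moreover have "\<forall>i\<in>I. a i \<in> {..<n} \<rightarrow>\<^sub>E Y" using a I(1) by blast
    ultimately have "(\<Inter>i\<in>I. hamming_ball n (f ` Y) t (relabel n f (a i))) \<noteq> {}"
      using balls_meet_relabel[OF inj, of I a n t] witness[OF I(1,3)] by simp
    then show "I \<in> ?G" using I by simp
  qed
  moreover have "finite ?G" by (rule finite_subset[of _ "Pow {1..m}"]) auto
  ultimately have "card ?F \<le> card ?G" by (rule card_mono[rotated])
  then have "\<alpha> * real (m choose (t + 2)) \<le> real (card {I. I \<subseteq> {1..m} \<and> card I = t + 2 \<and>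
          (\<Inter>i\<in>I. hamming_ball n (f ` Y) t (relabel n f (a i))) \<noteq> {}})"
    using hyp by linarith
  then have "\<exists>p \<in> {..<n} \<rightarrow>\<^sub>E f ` Y. c * \<alpha> * real m / (exp 1 * real (t + 1)) ^ (t + 1)
      \<le> real (card {i \<in> {1..m}. p \<in> hamming_ball n (f ` Y) t (relabel n f (a i))})"
    using rel[unfolded subsets_property_def Let_def] \<alpha> by blast
  then have "\<exists>p \<in> {..<n} \<rightarrow>\<^sub>E Y. c * \<alpha> * real m / (exp 1 * real (t + 1)) ^ (t + 1)
      \<le> real (card {i \<in> {1..m}. p \<in> hamming_ball n Y t (a i)})"
    by (intro covering_point_relabel[OF inj]) (use a in auto)
  then obtain p where p: "p \<in> {..<n} \<rightarrow>\<^sub>E Y" "c * \<alpha> * real m / (exp 1 * real (t + 1)) ^ (t + 1)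
      \<le> real (card {i \<in> {1..m}. p \<in> hamming_ball n Y t (a i)})" by blast
  have "p \<in> {..<n} \<rightarrow>\<^sub>E X" using p(1) YX by (auto simp: PiE_iff)
  then show "\<exists>p \<in> {..<n} \<rightarrow>\<^sub>E X. c * \<alpha> * real m / (exp 1 * real (t + 1)) ^ (t + 1)
      \<le> real (card {i \<in> {1..m}. p \<in> hamming_ball n X t (a i)})"
    using p by (intro bexI[of _ p]) (auto simp: hamming_ball_def)
qed

section \<open>Reduction to finite alphabets and transfer between types\<close>

text \<open>\<open>Y\<close> collects the symbols of all centres and of one common point for each
  nonempty intersecting index set. These are finitely many points with \<open>n\<close> symbols
  each, and the extra symbol \<open>x\<close> keeps \<open>Y\<close> nonempty.\<close>

lemma obtain_finite_subalphabet:
  fixes X :: "'a set" and a :: "nat \<Rightarrow> nat \<Rightarrow> 'a"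
  assumes "X \<noteq> {}" and a: "\<And>i. i \<in> {1..m} \<Longrightarrow> a i \<in> {..<n} \<rightarrow>\<^sub>E X"
  obtains Y where "finite Y" "Y \<noteq> {}" "Y \<subseteq> X" "\<forall>i\<in>{1..m}. a i \<in> {..<n} \<rightarrow>\<^sub>E Y"
    "\<forall>I \<subseteq> {1..m}. (\<Inter>i\<in>I. hamming_ball n X t (a i)) \<noteq> {} \<longrightarrow>
      (\<Inter>i\<in>I. hamming_ball n Y t (a i)) \<noteq> {}"
proof -
  define meets where "meets = {I. I \<noteq> {} \<and> I \<subseteq> {1..m} \<and> (\<Inter>i\<in>I. hamming_ball n X t (a i)) \<noteq> {}}"
  have fin: "finite meets" by (rule finite_subset[of _ "Pow {1..m}"]) (auto simp: meets_def)
  have "\<forall>I\<in>meets. \<exists>p. p \<in> (\<Inter>i\<in>I. hamming_ball n X t (a i))"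
    unfolding meets_def by blast
  from bchoice[OF this] obtain w where
    w: "\<And>I. I \<in> meets \<Longrightarrow> w I \<in> (\<Inter>i\<in>I. hamming_ball n X t (a i))"
    by fast
  obtain x where x: "x \<in> X" using assms by blast
  define Y where "Y = insert x ((\<Union>i\<in>{1..m}. a i ` {..<n}) \<union> (\<Union>I\<in>meets. w I ` {..<n}))"
  have wX: "w I \<in> {..<n} \<rightarrow>\<^sub>E X" if "I \<in> meets" for I
    using w[OF that] that by (auto simp: meets_def hamming_ball_def)
  show ?thesis
  proof
    show "finite Y" "Y \<noteq> {}" using fin by (auto simp: Y_def)
    show "Y \<subseteq> X" using x a wX by (fastforce simp: Y_def PiE_iff)
    show "\<forall>i\<in>{1..m}. a i \<in> {..<n} \<rightarrow>\<^sub>E Y"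
      using a by (auto simp: Y_def PiE_iff)
    have "(\<Inter>i\<in>I. hamming_ball n Y t (a i)) \<noteq> {}"
      if I: "I \<subseteq> {1..m}" "(\<Inter>i\<in>I. hamming_ball n X t (a i)) \<noteq> {}" for I
    proof (cases "I = {}")
      case False
      then have "I \<in> meets" using I by (simp add: meets_def)
      then have "w I \<in> {..<n} \<rightarrow>\<^sub>E Y" using wX[of I] by (auto simp: Y_def PiE_iff)
      then have "w I \<in> (\<Inter>i\<in>I. hamming_ball n Y t (a i))"
        using w[OF \<open>I \<in> meets\<close>] by (auto simp: hamming_ball_def)
      then show ?thesis by blast
    qed simp
    then show "\<forall>I \<subseteq> {1..m}. (\<Inter>i\<in>I. hamming_ball n X t (a i)) \<noteq> {} \<longrightarrow>
      (\<Inter>i\<in>I. hamming_ball n Y t (a i)) \<noteq> {}" by blast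
  qed
qed

text \<open>The bound for pairs involves \<open>card X\<close>, so there \<open>X\<close> itself is
  embedded into the naturals, which is possible because \<open>X\<close> is assumed finite. The
  bound for subsets allows alphabets too large to embed, but does not mention their size, so a
  finite subalphabet is embedded instead.\<close>

lemma works_for_alphabet_transfer:
  fixes X :: "'a set"
  assumes works: "\<And>Z :: nat set. Z \<noteq> {} \<Longrightarrow> works_for_alphabet c Z" and "X \<noteq> {}"
  shows "works_for_alphabet c X"
  unfolding works_for_alphabet_def
proof (intro allI impI conjI)
  fix m n t and a :: "nat \<Rightarrow> nat \<Rightarrow> 'a"
  assume mn: "1 \<le> m" "t < n" and a: "\<forall>i\<in>{1..m}. a i \<in> {..<n} \<rightarrow>\<^sub>E X"
  have both: "pairs_property c m n t (f ` Y) (\<lambda>i. relabel n f (a i)) \<and>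
      subsets_property c m n t (f ` Y) (\<lambda>i. relabel n f (a i))"
    if "Y \<noteq> {}" "\<And>i. i \<in> {1..m} \<Longrightarrow> a i \<in> {..<n} \<rightarrow>\<^sub>E Y" for f :: "'a \<Rightarrow> nat" and Y
  proof -
    have "works_for_alphabet c (f ` Y)" using that(1) works by simp
    moreover have "\<forall>i\<in>{1..m}. relabel n f (a i) \<in> {..<n} \<rightarrow>\<^sub>E f ` Y"
      unfolding relabel_image[symmetric] using that(2) by blast
    ultimately show ?thesis using mn by (simp add: works_for_alphabet_def)
  qed
  have a': "a i \<in> {..<n} \<rightarrow>\<^sub>E X" if "i \<in> {1..m}" for i using a that by blast
  show "pairs_property c m n t X a"
  proof (cases "finite X")
    case True
    then obtain f :: "'a \<Rightarrow> nat" where "inj_on f X"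
      using finite_imp_inj_to_nat_seg by blast
    then show ?thesis
      using a' both[OF assms(2) a', THEN conjunct1] by (rule pairs_property_relabel)
  qed (simp add: pairs_property_def)
  obtain Y where Y: "finite Y" "Y \<noteq> {}" "Y \<subseteq> X" and aY: "\<forall>i\<in>{1..m}. a i \<in> {..<n} \<rightarrow>\<^sub>E Y"
    and witness: "\<forall>I \<subseteq> {1..m}. (\<Inter>i\<in>I. hamming_ball n X t (a i)) \<noteq> {} \<longrightarrow>
      (\<Inter>i\<in>I. hamming_ball n Y t (a i)) \<noteq> {}"
    by (rule obtain_finite_subalphabet[OF assms(2) a'])
  have aY': "a i \<in> {..<n} \<rightarrow>\<^sub>E Y" if "i \<in> {1..m}" for i using aY that by blast
  obtain f :: "'a \<Rightarrow> nat" where f: "inj_on f Y"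
    using finite_imp_inj_to_nat_seg[OF Y(1)] by blast
  show "subsets_property c m n t X a"
    using f Y(3) aY' witness[rule_format] both[OF Y(2) aY', THEN conjunct2]
    by (rule subsets_property_relabel)
qed

theorem theorem4p1:
  "(\<exists>c>0. \<forall>X :: 'a set. X \<noteq> {} \<longrightarrow> works_for_alphabet c X) \<and>
   (\<forall>c>0. (\<forall>X :: nat set. X \<noteq> {} \<longrightarrow> works_for_alphabet c X) \<longrightarrow>
      (\<forall>X :: 'a set. X \<noteq> {} \<longrightarrow> works_for_alphabet c X))"
proof
  have "works_for_alphabet (1/4) X" if "X \<noteq> {}" for X :: "'a set"
    unfolding works_for_alphabet_def
  proof (intro allI impI conjI)
    fix m n t and a :: "nat \<Rightarrow> nat \<Rightarrow> 'a"
    assume "1 \<le> m" and "\<forall>i\<in>{1..m}. a i \<in> {..<n} \<rightarrow>\<^sub>E X"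
    then show "pairs_property (1/4) m n t X a" "subsets_property (1/4) m n t X a"
      using pairs_property_fourth[OF that, of m a n t] subsets_property_fourth[of m a n X t] by simp_all
  qed
  then show "\<exists>c>0. \<forall>X :: 'a set. X \<noteq> {} \<longrightarrow> works_for_alphabet c X"
    by (intro exI[of _ "1/4"]) auto
  show "\<forall>c>0. (\<forall>X :: nat set. X \<noteq> {} \<longrightarrow> works_for_alphabet c X) \<longrightarrow>
      (\<forall>X :: 'a set. X \<noteq> {} \<longrightarrow> works_for_alphabet c X)"
  proof (intro allI impI)
    fix c :: real and X :: "'a set"
    assume "\<forall>X :: nat set. X \<noteq> {} \<longrightarrow> works_for_alphabet c X" "X \<noteq> {}"
    from this(1)[rule_format] this(2) show "works_for_alphabet c X"
      by (rule works_for_alphabet_transfer)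
  qed
qed

end
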